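(* Let $q>2$ be a prime power and let $S$ be a minimal Rédei blocking set of index 3 in $PG(2,q)$ in standard triangle position (as defined in the context), with associated sets $A, B \subseteq GF(q)^*$, $1\in B$. Then the Rédei line $z=0$ contains $q$ points of $S$ if and only if for each $b_0 \in B\setminus\{1\}$ there exists $b_0^* \in B\setminus\{1\}$ such that $b_0 b_0^* \notin B$. Furthermore, if the Rédei line contains either $q$ or $q-1$ points of $S$, then it contains exactly $q-1$ points of $S$ if and only if $q$ is odd and $B$ is a proper union of multiplicative cosets of the subgroup $\{1,-1\}$ of $GF(q)^*$ (proper meaning nonempty and not all of $GF(q)^*$).
   Context: A (proper) blocking set in $PG(2,q)$ is a set $S$ of points meeting every line and containing no line. It is minimal if it does not properly contain a smaller blocking set, equivalently each of its points is essential, i.e. lies on a line meeting $S$ only in that point. The index of $S$ is the minimum number of lines whose union contains $S$. A minimal Rédei blocking set is a minimal blocking set with $q+n$ points for which the maximum number of its points on a line is $n$; a line containing $n$ of its points is called a Rédei line. Points have homogeneous coordinates $(x,y,z)$; affine points are those with $z\neq 0$, and $(x,y)$ denotes $(x,y,1)$. $GF(q)^* = GF(q)\setminus\{0\}$. Standard triangle position: $S$ is contained in the union of the three lines $z=0$, $x=0$ and $y=0$; the line $z=0$ is a Rédei line of $S$; the points $(1,0,0)$, $(0,1,0)$, $(0,0,1)$ all belong to $S$ and $(1,1,0)\notin S$. The affine points of $S$ are then $(0,0)$ together with $\{(0,a) : a\in A\}\cup\{(b,0) : b\in B\}$, where $A\subseteq GF(q)^*$, $B = GF(q)^*\setminus(-A)$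 with $-A=\{-a : a\in A\}$, both $A$ and $B$ are nonempty, and one normalizes so that $-1\notin A$, i.e. $1\in B$. *)

theory Defs
  imports Main "HOL-Library.Cardinality"
begin

text \<open>
  The field \<open>GF(q)\<close> is a type \<open>'a :: {field, finite}\<close> with \<open>q = CARD('a)\<close>. A point of
  \<open>PG(2,q)\<close> is the set of all its homogeneous coordinate triples, i.e. a class of nonzero
  triples up to nonzero scalars; a line is identified with the set of its points.
\<close>

type_synonym 'a pg_point = "('a \<times> 'a \<times> 'a) set"

definition pt :: "'a::field \<Rightarrow> 'a \<Rightarrow> 'a \<Rightarrow> 'a pg_point" where
  "pt x y z = {(k * x, k * y, k * z) | k. k \<noteq> 0}"

definition points :: "'a::field pg_point set" where
  "points = {pt x y z | x y z. (x, y, z) \<noteq> (0, 0, 0)}"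

definition line :: "'a::field \<Rightarrow> 'a \<Rightarrow> 'a \<Rightarrow> 'a pg_point set" where
  "line a b c = {pt x y z | x y z. (x, y, z) \<noteq> (0, 0, 0) \<and> a * x + b * y + c * z = 0}"

definition lines :: "'a::field pg_point set set" where
  "lines = {line a b c | a b c. (a, b, c) \<noteq> (0, 0, 0)}"

definition blocking_set :: "'a::field pg_point set \<Rightarrow> bool" where
  "blocking_set S \<longleftrightarrow>
     S \<subseteq> points \<and> (\<forall>l\<in>lines. S \<inter> l \<noteq> {}) \<and> (\<forall>l\<in>lines. \<not> l \<subseteq> S)"

definition minimal_blocking_set :: "'a::field pg_point set \<Rightarrow> bool" where
  "minimal_blocking_set S \<longleftrightarrow> blocking_set S \<and> \<not> (\<exists>T. T \<subset> S \<and> blocking_set T)"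

definition blocking_index :: "'a::field pg_point set \<Rightarrow> nat" where
  "blocking_index S = (LEAST n. \<exists>L \<subseteq> lines. finite L \<and> card L = n \<and> S \<subseteq> \<Union>L)"

definition max_on_line :: "'a::{field,finite} pg_point set \<Rightarrow> nat" where
  "max_on_line S = Max {card (S \<inter> l) | l. l \<in> lines}"

definition minimal_redei_blocking_set :: "'a::{field,finite} pg_point set \<Rightarrow> bool" where
  "minimal_redei_blocking_set S \<longleftrightarrow>
     minimal_blocking_set S \<and> card S = CARD('a) + max_on_line S"

definition redei_line :: "'a::{field,finite} pg_point set \<Rightarrow> 'a pg_point set \<Rightarrow> bool" where
  "redei_line S l \<longleftrightarrow> l \<in> lines \<and> card (S \<inter> l) = max_on_line S"

definition standard_triangle_position :: "'a::{field,finite} pg_point set \<Rightarrow> bool" where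
  "standard_triangle_position S \<longleftrightarrow>
     S \<subseteq> line 0 0 1 \<union> line 1 0 0 \<union> line 0 1 0 \<and>
     redei_line S (line 0 0 1) \<and>
     pt 1 0 0 \<in> S \<and> pt 0 1 0 \<in> S \<and> pt 0 0 1 \<in> S \<and>
     pt 1 1 0 \<notin> S"

text \<open>
  The sets \<open>A\<close> and \<open>B\<close> attached to \<open>S\<close>. For a minimal Redei blocking set of index 3 in
  standard triangle position, \<open>B = GF(q)\<^sup>* - (-A)\<close> and \<open>A, B \<noteq> {}\<close> are consequences:
  the lines through \<open>(1,1,0)\<close> must be blocked by the \<open>q\<close> affine points of \<open>S\<close>, and \<open>S\<close> is
  not covered by two lines.
\<close>

definition set_A :: "'a::field pg_point set \<Rightarrow> 'a set" where
  "set_A S = {a. a \<noteq> 0 \<and> pt 0 a 1 \<in> S}"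

definition set_B :: "'a::field pg_point set \<Rightarrow> 'a set" where
  "set_B S = {b. b \<noteq> 0 \<and> pt b 0 1 \<in> S}"

definition pm1_cosets :: "'a::field set set" where
  "pm1_cosets = {(\<lambda>h. c * h) ` {1, -1} | c. c \<noteq> 0}"

definition proper_union_of_pm1_cosets :: "'a::field set \<Rightarrow> bool" where
  "proper_union_of_pm1_cosets B \<longleftrightarrow>
     (\<exists>C \<subseteq> pm1_cosets. B = \<Union>C) \<and> B \<noteq> {} \<and> B \<noteq> UNIV - {0}"

end

theory Submission
  imports Defs
begin

text \<open>
  Write \<open>q\<close> for the order of the field and \<open>U\<close> for the set of affine points of \<open>S\<close>; there are
  exactly \<open>q\<close> of them, because \<open>S\<close> has \<open>q\<close> more points than its Redei line. The \<open>q\<close> affine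
  lines of slope \<open>m\<close> are the level sets of \<open>(x, y) \<mapsto> y - m * x\<close>. If the point \<open>(1, m, 0)\<close> is
  not in \<open>S\<close>, each of these lines must be blocked by an affine point, so this function maps
  \<open>U\<close> onto the field. Conversely, if \<open>(1, m, 0)\<close> is in \<open>S\<close>, it is essential by minimality, and a
  tangent line at it is an affine line (the Redei line contains more than one point of \<open>S\<close>) that
  misses \<open>U\<close>. So \<open>(1, m, 0) \<notin> S\<close> holds iff \<open>{0} \<union> A \<union> -m B\<close> is the whole field
  (\<open>ideal_point_notin_iff_standard\<close>).

  For \<open>m = 1\<close> this and \<open>1 + |A| + |B| = q\<close> give that \<open>A\<close> is the complement of \<open>-B\<close> in the
  multiplicative group. Then for \<open>m \<noteq> 0\<close> the condition becomes \<open>m B = B\<close>, and the Redei line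
  contains exactly \<open>q + 1 - |H|\<close> points of \<open>S\<close>, where \<open>H\<close> is the multiplicative stabilizer of
  \<open>B\<close> (\<open>card_redei_line\<close>).

  The rest is algebra. As \<open>1 \<in> B\<close>, \<open>H \<subseteq> B\<close>, and the first claim says that \<open>H\<close> is trivial iff
  multiplication by \<open>b\<close> maps \<open>B\<close> into itself for no \<open>b \<noteq> 1\<close> in \<open>B\<close>; the element of \<open>B\<close> mapped
  outside \<open>B\<close> is never \<open>1\<close>, as \<open>b * 1 \<in> B\<close>. For the second claim, a group \<open>H\<close> of order two is
  \<open>{1, -1}\<close> with \<open>-1 \<noteq> 1\<close>, that is, with \<open>q\<close> odd. Here \<open>B\<close> is not the whole multiplicative
  group, for otherwise \<open>A\<close> would be empty and two lines would cover \<open>S\<close>.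
\<close>

section \<open>Points and lines in homogeneous coordinates\<close>

lemma pt_eq_iff:
  "pt x y z = pt x' y' z' \<longleftrightarrow> (\<exists>k. k \<noteq> 0 \<and> x' = k * x \<and> y' = k * y \<and> z' = k * z)"
proof
  assume "pt x y z = pt x' y' z'"
  moreover have "(x', y', z') \<in> pt x' y' z'"
    unfolding pt_def by (intro CollectI exI[of _ 1]) simp
  ultimately have "(x', y', z') \<in> pt x y z" by simp
  then show "\<exists>k. k \<noteq> 0 \<and> x' = k * x \<and> y' = k * y \<and> z' = k * z"
    unfolding pt_def by auto
next
  assume "\<exists>k. k \<noteq> 0 \<and> x' = k * x \<and> y' = k * y \<and> z' = k * z"
  then obtain k where k: "k \<noteq> 0" "x' = k * x" "y' = k * y" "z' = k * z" by blast
  show "pt x y z = pt x' y' z'"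
  proof
    show "pt x y z \<subseteq> pt x' y' z'"
    proof
      fix p assume "p \<in> pt x y z"
      then obtain j where j: "j \<noteq> 0" "p = (j * x, j * y, j * z)" unfolding pt_def by auto
      then have "j / k \<noteq> 0 \<and> p = ((j / k) * x', (j / k) * y', (j / k) * z')"
        using k by simp
      then show "p \<in> pt x' y' z'" unfolding pt_def by blast
    qed
    show "pt x' y' z' \<subseteq> pt x y z"
    proof
      fix p assume "p \<in> pt x' y' z'"
      then obtain j where j: "j \<noteq> 0" "p = (j * x', j * y', j * z')" unfolding pt_def by auto
      then have "j * k \<noteq> 0 \<and> p = ((j * k) * x, (j * k) * y, (j * k) * z)"
        using k by (simp add: mult.assoc)
      then show "p \<in> pt x y z" unfolding pt_def by blast
    qed
  qed
qed

lemma pt_in_line_iff: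
  assumes "(x, y, z) \<noteq> (0, 0, 0)"
  shows "pt x y z \<in> line a b c \<longleftrightarrow> a * x + b * y + c * z = 0"
proof
  assume "pt x y z \<in> line a b c"
  then obtain x' y' z' where p: "pt x y z = pt x' y' z'" and l: "a * x' + b * y' + c * z' = 0"
    unfolding line_def by blast
  from p obtain k where k: "k \<noteq> 0" "x' = k * x" "y' = k * y" "z' = k * z"
    unfolding pt_eq_iff by blast
  have "k * (a * x + b * y + c * z) = 0" using l k by (simp add: algebra_simps)
  then show "a * x + b * y + c * z = 0" using k by simp
qed (use assms in \<open>auto simp: line_def\<close>)

lemma affine_pt_eq_iff: "pt x y 1 = pt x' y' 1 \<longleftrightarrow> x = x' \<and> y = y'"
  by (auto simp: pt_eq_iff)

lemma ideal_pt_eq_iff: "pt 1 m 0 = pt 1 m' 0 \<longleftrightarrow> m = m'"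
  by (auto simp: pt_eq_iff)

lemma affine_pt_cases:
  assumes "p \<in> points" and "p \<notin> line 0 0 1"
  obtains x y where "p = pt x y 1"
proof -
  obtain x y z where p: "p = pt x y z" "(x, y, z) \<noteq> (0, 0, 0)"
    using assms(1) unfolding points_def by blast
  then have z: "z \<noteq> 0" using assms(2) by (auto simp: pt_in_line_iff)
  have "p = pt (x / z) (y / z) 1"
    unfolding p pt_eq_iff using z by (intro exI[of _ "1 / z"]) simp
  then show ?thesis by (rule that)
qed

lemma line_at_infinity: "line 0 0 1 = insert (pt 0 1 0) (range (\<lambda>m. pt 1 m 0))"
proof (rule set_eqI, rule iffI)
  fix p :: "'a pg_point" assume "p \<in> line 0 0 1"
  then obtain x y where p: "p = pt x y 0" "(x, y) \<noteq> (0, 0)" unfolding line_def by auto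
  show "p \<in> insert (pt 0 1 0) (range (\<lambda>m. pt 1 m 0))"
  proof (cases "x = 0")
    case True
    then have "p = pt 0 1 0"
      unfolding p pt_eq_iff using p by (intro exI[of _ "1 / y"]) simp
    then show ?thesis by simp
  next
    case False
    then have "p = pt 1 (y / x) 0"
      unfolding p pt_eq_iff by (intro exI[of _ "1 / x"]) simp
    then show ?thesis by simp
  qed
qed (auto simp: pt_in_line_iff)

lemma line_in_lines:
  assumes "(a, b, c) \<noteq> (0, 0, 0)"
  shows "line a b c \<in> lines"
  unfolding lines_def using assms by blast

lemma minimal_blocking_set_subset_points: "minimal_blocking_set S \<Longrightarrow> S \<subseteq> points"
  unfolding minimal_blocking_set_def blocking_set_def by simp

lemma minimal_blocking_set_meets_line:
  assumes "minimal_blocking_set S" and "l \<in> lines"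
  shows "S \<inter> l \<noteq> {}"
  using assms unfolding minimal_blocking_set_def blocking_set_def by simp

lemma minimal_blocking_set_tangent:
  assumes "minimal_blocking_set S" and "P \<in> S"
  obtains l where "l \<in> lines" and "S \<inter> l = {P}"
proof -
  have S: "blocking_set S" and not: "\<not> blocking_set (S - {P})"
    using assms unfolding minimal_blocking_set_def by auto
  have "S - {P} \<subseteq> points" and "\<forall>l\<in>lines. \<not> l \<subseteq> S - {P}"
    using S unfolding blocking_set_def by (meson Diff_subset order_trans)+
  with not obtain l where l: "l \<in> lines" "(S - {P}) \<inter> l = {}"
    unfolding blocking_set_def by metis
  moreover have "S \<inter> l \<noteq> {}" using S l(1) unfolding blocking_set_def by blast
  ultimately have "S \<inter> l = {P}" by blast
  with l(1) show ?thesis by (rule that)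
qed

text \<open>The affine lines \<open>y - m * x = c\<close> are those through \<open>(1, m, 0)\<close> other than the line at infinity,
  so the right-hand side says that the affine points of \<open>S\<close> already block all of them.\<close>

lemma ideal_point_notin_iff:
  assumes min: "minimal_blocking_set S" and X: "pt 1 0 0 \<in> S" and Y: "pt 0 1 0 \<in> S"
  shows "pt 1 m 0 \<notin> S \<longleftrightarrow> (\<forall>c. \<exists>x y. pt x y 1 \<in> S \<and> y - m * x = c)"
proof
  assume out: "pt 1 m 0 \<notin> S"
  show "\<forall>c. \<exists>x y. pt x y 1 \<in> S \<and> y - m * x = c"
  proof
    fix c
    have "line m (-1) c \<in> lines" by (rule line_in_lines) simp
    then obtain p where p: "p \<in> S" "p \<in> line m (-1) c"
      using minimal_blocking_set_meets_line[OF min] by blast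
    have "p \<noteq> pt 0 1 0" using p(2) by (auto simp: pt_in_line_iff)
    moreover have "p \<noteq> pt 1 m' 0" for m' using p out by (auto simp: pt_in_line_iff)
    ultimately have "p \<notin> line 0 0 1" unfolding line_at_infinity by blast
    moreover have "p \<in> points"
      using p(1) minimal_blocking_set_subset_points[OF min] by blast
    ultimately obtain x y where xy: "p = pt x y 1" using affine_pt_cases[of p] by blast
    then have "y - m * x = c" using p(2) by (simp add: pt_in_line_iff algebra_simps)
    then show "\<exists>x y. pt x y 1 \<in> S \<and> y - m * x = c" using p(1) xy by blast
  qed
next
  assume all: "\<forall>c. \<exists>x y. pt x y 1 \<in> S \<and> y - m * x = c"
  show "pt 1 m 0 \<notin> S"
  proof
    assume "pt 1 m 0 \<in> S"
    with min obtain l where l: "l \<in> lines" "S \<inter> l = {pt 1 m 0}"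
      by (rule minimal_blocking_set_tangent)
    obtain a b c where abc: "l = line a b c" "(a, b, c) \<noteq> (0, 0, 0)"
      using l(1) unfolding lines_def by blast
    have "pt 1 m 0 \<in> line a b c" using l(2) abc(1) by blast
    then have a: "a = - (b * m)" by (simp add: pt_in_line_iff eq_neg_iff_add_eq_0)
    have b: "b \<noteq> 0"
    proof
      \<comment> \<open>Otherwise the tangent is the line at infinity, which contains more than one point of \<open>S\<close>.\<close>
      assume "b = 0"
      then have "pt 1 0 0 \<in> S \<inter> l" "pt 0 1 0 \<in> S \<inter> l"
        using a abc X Y by (auto simp: pt_in_line_iff)
      then have "pt 1 0 0 = pt (0::'a) 1 0" using l(2) by auto
      then show False by (auto simp: pt_eq_iff)
    qed
    obtain x y where xy: "pt x y 1 \<in> S" "y - m * x = - (c / b)" using all by blast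
    have "b * (y - m * x) = - c" using xy(2) b by simp
    then have "a * x + b * y + c * 1 = 0" using a by (simp add: algebra_simps)
    then have "pt x y 1 \<in> S \<inter> l" using xy abc by (simp add: pt_in_line_iff)
    then have "pt x y 1 = pt 1 m 0" using l(2) by blast
    then show False by (auto simp: pt_eq_iff)
  qed
qed

section \<open>The Redei line and the multiplicative stabilizer\<close>

text \<open>The elements of the multiplicative group that fix \<open>B\<close> setwise under multiplication.\<close>

definition mult_stabilizer :: "'a::field set \<Rightarrow> 'a set" where
  "mult_stabilizer B = {m. m \<noteq> 0 \<and> (\<lambda>b. m * b) ` B = B}"

lemma mult_stabilizer_iff_maps_into:
  assumes "finite B"
  shows "m \<in> mult_stabilizer B \<longleftrightarrow> m \<noteq> 0 \<and> (\<forall>b\<in>B. m * b \<in> B)"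
proof
  assume r: "m \<noteq> 0 \<and> (\<forall>b\<in>B. m * b \<in> B)"
  then have "inj_on (\<lambda>b. m * b) B" by (auto intro: inj_onI)
  then have "(\<lambda>b. m * b) ` B = B"
    using r assms by (intro endo_inj_surj) auto
  then show "m \<in> mult_stabilizer B" using r unfolding mult_stabilizer_def by simp
qed (auto simp: mult_stabilizer_def)

lemma mult_stabilizer_iff_covers:
  assumes "finite B"
  shows "m \<in> mult_stabilizer B \<longleftrightarrow> m \<noteq> 0 \<and> B \<subseteq> (\<lambda>b. m * b) ` B"
proof
  assume r: "m \<noteq> 0 \<and> B \<subseteq> (\<lambda>b. m * b) ` B"
  then have "(\<lambda>b. m * b) ` B = B"
    using assms by (metis card_image_le card_seteq finite_imageI)
  then show "m \<in> mult_stabilizer B" using r unfolding mult_stabilizer_def by simp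
qed (auto simp: mult_stabilizer_def)

lemma affine_points_standard:
  assumes "standard_triangle_position S" and "S \<subseteq> points"
  shows "S - line 0 0 1 = {pt 0 0 1} \<union> (\<lambda>a. pt 0 a 1) ` set_A S \<union> (\<lambda>b. pt b 0 1) ` set_B S"
proof (rule set_eqI, rule iffI)
  fix p assume p: "p \<in> S - line 0 0 1"
  then obtain x y where xy: "p = pt x y 1"
    using assms(2) affine_pt_cases[of p] by blast
  have "p \<in> line 1 0 0 \<union> line 0 1 0"
    using p assms(1) unfolding standard_triangle_position_def by blast
  then have "x = 0 \<or> y = 0" by (auto simp: xy pt_in_line_iff)
  then show "p \<in> {pt 0 0 1} \<union> (\<lambda>a. pt 0 a 1) ` set_A S \<union> (\<lambda>b. pt b 0 1) ` set_B S"
    using p xy unfolding set_A_def set_B_def by auto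
qed (use assms in \<open>auto simp: standard_triangle_position_def set_A_def set_B_def pt_in_line_iff\<close>)

lemma card_A_B:
  fixes S :: "'a::{field,finite} pg_point set"
  assumes "minimal_redei_blocking_set S" and "standard_triangle_position S"
  shows "1 + card (set_A S) + card (set_B S) = CARD('a)"
proof -
  let ?A = "(\<lambda>a. pt 0 a 1) ` set_A S" and ?B = "(\<lambda>b. pt b 0 1) ` set_B S"
  have sub: "S \<subseteq> points"
    using assms(1) minimal_blocking_set_subset_points
    unfolding minimal_redei_blocking_set_def by blast
  have fin: "finite S" by (rule finite)
  have "card (S - line 0 0 1) = card S - card (S \<inter> line 0 0 1)"
    using fin by (simp add: card_Diff_subset_Int)
  also have "\<dots> = CARD('a)"
    using assms
    unfolding minimal_redei_blocking_set_def standard_triangle_position_def redei_line_def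
    by simp
  finally have "CARD('a) = card ({pt 0 0 1} \<union> ?A \<union> ?B)"
    by (simp add: affine_points_standard[OF assms(2) sub])
  also have "\<dots> = card ({pt 0 0 1} \<union> ?A) + card ?B"
    by (rule card_Un_disjoint) (auto simp: set_A_def set_B_def affine_pt_eq_iff)
  also have "card ({pt 0 0 1} \<union> ?A) = 1 + card ?A"
    by (subst card_Un_disjoint) (auto simp: set_A_def affine_pt_eq_iff)
  also have "card ?A = card (set_A S)"
    by (rule card_image) (auto intro: inj_onI simp: affine_pt_eq_iff)
  also have "card ?B = card (set_B S)"
    by (rule card_image) (auto intro: inj_onI simp: affine_pt_eq_iff)
  finally show ?thesis by simp
qed

text \<open>On the three kinds of affine points, \<open>(0, 0)\<close>, \<open>(0, a)\<close> and \<open>(b, 0)\<close>, the function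
  \<open>y - m * x\<close> takes the values \<open>0\<close>, \<open>a\<close> and \<open>- (m * b)\<close>.\<close>

lemma ideal_point_notin_iff_standard:
  assumes min: "minimal_blocking_set S" and std: "standard_triangle_position S"
  shows "pt 1 m 0 \<notin> S \<longleftrightarrow> {0} \<union> set_A S \<union> (\<lambda>b. - (m * b)) ` set_B S = UNIV"
proof -
  have XY: "pt 1 0 0 \<in> S" "pt 0 1 0 \<in> S"
    using std unfolding standard_triangle_position_def by blast+
  have sub: "S \<subseteq> points" using minimal_blocking_set_subset_points[OF min] .
  have "(\<exists>x y. pt x y 1 \<in> S \<and> y - m * x = c) \<longleftrightarrow>
      c \<in> {0} \<union> set_A S \<union> (\<lambda>b. - (m * b)) ` set_B S" (is "?L \<longleftrightarrow> ?R") for c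
  proof
    assume ?L
    then obtain x y where xy: "pt x y 1 \<in> S" "y - m * x = c" by blast
    then have "pt x y 1 \<in> S - line 0 0 1" by (simp add: pt_in_line_iff)
    then show ?R
      unfolding affine_points_standard[OF std sub] using xy(2) by (auto simp: affine_pt_eq_iff)
  next
    assume ?R
    then consider "c = 0" | "c \<in> set_A S" | b where "b \<in> set_B S" "c = - (m * b)" by blast
    then show ?L
    proof cases
      case 1
      then show ?thesis
        using std unfolding standard_triangle_position_def
        by (intro exI[of _ 0]) simp
    next
      case 2
      then show ?thesis
        unfolding set_A_def by (intro exI[of _ 0] exI[of _ c]) simp
    next
      case 3
      then show ?thesis
        unfolding set_B_def by (intro exI[of _ b] exI[of _ 0]) simp
    qed
  qed
  then show ?thesis unfolding ideal_point_notin_iff[OF min XY] by blast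
qed

lemma set_A_eq:
  fixes S :: "'a::{field,finite} pg_point set"
  assumes red: "minimal_redei_blocking_set S" and std: "standard_triangle_position S"
  shows "set_A S = - {0} - uminus ` set_B S"
proof -
  have min: "minimal_blocking_set S" using red unfolding minimal_redei_blocking_set_def by blast
  have "pt 1 1 0 \<notin> S" using std unfolding standard_triangle_position_def by blast
  then have un: "{0} \<union> set_A S \<union> uminus ` set_B S = UNIV"
    using ideal_point_notin_iff_standard[OF min std, of 1] by simp
  have 0: "0 \<notin> set_A S" "0 \<notin> uminus ` set_B S" unfolding set_A_def set_B_def by auto
  have B: "card (uminus ` set_B S) = card (set_B S)" by (simp add: card_image)
  have "CARD('a) = card ({0} \<union> (set_A S \<union> uminus ` set_B S))" using un by (simp add: Un_assoc)
  also have "\<dots> = 1 + card (set_A S \<union> uminus ` set_B S)"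
    using 0 by (subst card_Un_disjoint) auto
  finally have "card (set_A S) + card (uminus ` set_B S) = card (set_A S \<union> uminus ` set_B S)"
    using card_A_B[OF red std] B by simp
  then have "card (set_A S \<inter> uminus ` set_B S) = 0"
    using card_Un_Int[of "set_A S" "uminus ` set_B S"] by simp
  then have "set_A S \<inter> uminus ` set_B S = {}" by simp
  then show ?thesis using un 0 by blast
qed

lemma ideal_point_notin_iff_stabilizer:
  fixes S :: "'a::{field,finite} pg_point set"
  assumes red: "minimal_redei_blocking_set S" and std: "standard_triangle_position S"
  shows "pt 1 m 0 \<notin> S \<longleftrightarrow> m \<in> mult_stabilizer (set_B S)"
proof (cases "m = 0")
  case True
  then show ?thesis
    using std unfolding standard_triangle_position_def mult_stabilizer_def by simp
next
  case False
  have min: "minimal_blocking_set S" using red unfolding minimal_redei_blocking_set_def by blast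
  let ?B = "set_B S"
  have 0: "0 \<notin> ?B" unfolding set_B_def by simp
  have "pt 1 m 0 \<notin> S \<longleftrightarrow> {0} \<union> (- {0} - uminus ` ?B) \<union> (\<lambda>b. - (m * b)) ` ?B = UNIV"
    unfolding ideal_point_notin_iff_standard[OF min std] set_A_eq[OF red std] ..
  also have "\<dots> \<longleftrightarrow> uminus ` ?B \<subseteq> uminus ` (\<lambda>b. m * b) ` ?B"
  proof -
    have "{0} \<union> (- {0} - X) \<union> Y = UNIV \<longleftrightarrow> X \<subseteq> Y" if "0 \<notin> X" for X Y :: "'a set"
      using that by (simp add: set_eq_iff subset_iff) metis
    moreover have "0 \<notin> uminus ` ?B" using 0 by auto
    ultimately show ?thesis unfolding image_image by simp
  qed
  also have "\<dots> \<longleftrightarrow> ?B \<subseteq> (\<lambda>b. m * b) ` ?B"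
    by (rule inj_image_subset_iff) simp
  also have "\<dots> \<longleftrightarrow> m \<in> mult_stabilizer ?B"
    using False by (simp add: mult_stabilizer_iff_covers)
  finally show ?thesis .
qed

lemma card_redei_line:
  fixes S :: "'a::{field,finite} pg_point set"
  assumes red: "minimal_redei_blocking_set S" and std: "standard_triangle_position S"
  shows "card (S \<inter> line 0 0 1) + card (mult_stabilizer (set_B S)) = CARD('a) + 1"
proof -
  let ?H = "mult_stabilizer (set_B S)" and ?f = "\<lambda>m::'a. pt 1 m 0"
  have Y: "pt 0 1 0 \<in> S" using std unfolding standard_triangle_position_def by blast
  have inj: "inj_on ?f X" for X by (auto intro: inj_onI simp: ideal_pt_eq_iff)
  have "line 0 0 1 - S = ?f ` ?H"
    unfolding line_at_infinity using ideal_point_notin_iff_stabilizer[OF red std] Y by auto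
  then have H: "card (line 0 0 1 - S) = card ?H" by (simp add: card_image inj)
  have "pt 0 1 0 \<notin> range ?f" by (auto simp: pt_eq_iff)
  then have L: "card (line 0 0 (1::'a)) = CARD('a) + 1"
    unfolding line_at_infinity by (simp add: card_image inj)
  have "(S \<inter> line 0 0 1) \<union> (line 0 0 1 - S) = line 0 0 1" by blast
  then have "card (line 0 0 (1::'a)) = card ((S \<inter> line 0 0 1) \<union> (line 0 0 1 - S))"
    by (simp only:)
  also have "\<dots> = card (S \<inter> line 0 0 1) + card (line 0 0 1 - S)"
    by (rule card_Un_disjoint) auto
  finally show ?thesis using H L by simp
qed

lemma blocking_index_le:
  assumes "L \<subseteq> lines" and "finite L" and "S \<subseteq> \<Union>L"
  shows "blocking_index S \<le> card L"
  unfolding blocking_index_def using assms by (intro Least_le) blast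

lemma set_A_nonempty:
  fixes S :: "'a::{field,finite} pg_point set"
  assumes std: "standard_triangle_position S" and sub: "S \<subseteq> points" and ind: "blocking_index S = 3"
  shows "set_A S \<noteq> {}"
proof
  assume "set_A S = {}"
  then have "S - line 0 0 1 \<subseteq> line 0 1 0"
    unfolding affine_points_standard[OF std sub] by (auto simp: pt_in_line_iff)
  then have "S \<subseteq> \<Union> {line 0 0 1, line 0 1 0}" by auto
  moreover have "{line 0 0 1, line 0 1 (0::'a)} \<subseteq> lines" by (simp add: line_in_lines)
  ultimately have "blocking_index S \<le> card {line 0 0 1, line 0 1 (0::'a)}"
    by (intro blocking_index_le) auto
  also have "\<dots> \<le> 2" by (simp add: card_insert_if)
  finally show False using ind by simp
qed

section \<open>Stabilizers of order one and two\<close>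

lemma odd_card_iff_neg_one_neq_one:
  "odd CARD('a::{field,finite}) \<longleftrightarrow> (-1::'a) \<noteq> 1"
proof
  assume odd: "odd CARD('a)"
  \<comment> \<open>Translation by \<open>1\<close> permutes the field, so \<open>q = 0\<close> in the field.\<close>
  have "(\<Sum>x\<in>UNIV. x) = (\<Sum>x\<in>UNIV. x + (1::'a))"
    by (rule sum.reindex_bij_witness[of _ "\<lambda>x. x + 1" "\<lambda>x. x - 1"]) auto
  then have 0: "of_nat CARD('a) = (0::'a)" by (simp add: sum.distrib)
  show "(-1::'a) \<noteq> 1"
  proof
    assume "(-1::'a) = 1"
    then have 2: "(2::'a) = 0" by (metis add.right_inverse one_add_one)
    from odd obtain k where "CARD('a) = 2 * k + 1" by (rule oddE)
    then show False using 0 2 by simp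
  qed
next
  assume ne: "(-1::'a) \<noteq> 1"
  have ne': "x \<noteq> - x" if "x \<noteq> 0" for x :: 'a
  proof
    assume "x = - x"
    then have "x * 1 = x * (-1)" by simp
    then show False using that ne by (metis mult_left_cancel)
  qed
  \<comment> \<open>The pairs \<open>{x, - x}\<close> partition the nonzero elements.\<close>
  let ?P = "(\<lambda>x::'a. {x, - x}) ` (- {0})"
  have "2 * card ?P = card (\<Union> ?P)"
  proof (rule card_partition)
    fix c assume "c \<in> ?P"
    then obtain x where "c = {x, - x}" "x \<noteq> 0" by blast
    then show "card c = 2" using ne'[of x] by simp
  next
    fix c d assume "c \<in> ?P" "d \<in> ?P" "c \<noteq> d"
    then obtain x y where xy: "c = {x, - x}" "d = {y, - y}" "{x, - x} \<noteq> {y, - y}" by blast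
    then have "x \<noteq> y" "x \<noteq> - y" by auto
    then show "c \<inter> d = {}" unfolding xy by (auto simp: minus_equation_iff)
  qed simp_all
  also have "\<Union> ?P = - {0}" by auto
  also have "card (- {0::'a}) = CARD('a) - 1" by (simp add: Compl_eq_Diff_UNIV)
  finally have "CARD('a) - 1 = 2 * card ?P" ..
  moreover have "CARD('a) > 0" by simp
  ultimately have "CARD('a) = 2 * card ?P + 1" by linarith
  then show "odd CARD('a)" by simp
qed

lemma one_in_mult_stabilizer: "1 \<in> mult_stabilizer B"
  unfolding mult_stabilizer_def by simp

lemma mult_stabilizer_mult:
  assumes "m \<in> mult_stabilizer B" and "n \<in> mult_stabilizer B"
  shows "m * n \<in> mult_stabilizer B"
proof -
  have "(\<lambda>b. m * n * b) ` B = (\<lambda>b. m * b) ` (\<lambda>b. n * b) ` B"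
    by (simp add: image_image mult.assoc)
  then show ?thesis using assms unfolding mult_stabilizer_def by simp
qed

lemma mult_stabilizer_trivial_iff:
  assumes "finite B" and "0 \<notin> B" and "1 \<in> B"
  shows "mult_stabilizer B = {1} \<longleftrightarrow> (\<forall>b\<in>B - {1}. \<exists>b'\<in>B - {1}. b * b' \<notin> B)"
proof -
  have H: "m \<in> mult_stabilizer B \<longleftrightarrow> m \<in> B \<and> (\<forall>b\<in>B - {1}. m * b \<in> B)" for m
    using assms by (fastforce simp: mult_stabilizer_iff_maps_into)
  show ?thesis using one_in_mult_stabilizer[of B] H by blast
qed

lemma card_mult_stabilizer_eq_1_iff: "card (mult_stabilizer B) = 1 \<longleftrightarrow> mult_stabilizer B = {1}"
  using one_in_mult_stabilizer[of B] by (auto simp: card_1_singleton_iff)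

lemma mult_stabilizer_order_two:
  fixes B :: "'a::field set"
  assumes "card (mult_stabilizer B) = 2"
  shows "-1 \<in> mult_stabilizer B" and "(-1::'a) \<noteq> 1"
proof -
  have "card (mult_stabilizer B - {1}) = 1"
    using assms one_in_mult_stabilizer[of B] by simp
  then obtain m where "mult_stabilizer B - {1} = {m}" by (rule card_1_singletonE)
  then have m: "mult_stabilizer B = {1, m}" "m \<noteq> 1"
    using one_in_mult_stabilizer[of B] by auto
  have "m \<noteq> 0" using m(1) unfolding mult_stabilizer_def by auto
  have "m * m \<in> {1, m}" using mult_stabilizer_mult[of m B m] m(1) by simp
  then have "m * m = 1" using m(2) \<open>m \<noteq> 0\<close> by auto
  then have "m = -1" using m(2) by (simp add: square_eq_1_iff)
  then show "-1 \<in> mult_stabilizer B" "(-1::'a) \<noteq> 1" using m by simp_all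
qed

lemma union_of_pm1_cosets_iff:
  fixes B :: "'a::{field,finite} set"
  shows "(\<exists>C\<subseteq>pm1_cosets. B = \<Union>C) \<longleftrightarrow> 0 \<notin> B \<and> -1 \<in> mult_stabilizer B"
proof
  assume "\<exists>C\<subseteq>pm1_cosets. B = \<Union>C"
  then obtain C where "C \<subseteq> pm1_cosets" "B = \<Union>C" by blast
  then show "0 \<notin> B \<and> -1 \<in> mult_stabilizer B"
    unfolding mult_stabilizer_iff_maps_into[OF finite] pm1_cosets_def by fastforce
next
  assume r: "0 \<notin> B \<and> -1 \<in> mult_stabilizer B"
  then have neg: "- b \<in> B" if "b \<in> B" for b
    using that by (auto simp: mult_stabilizer_iff_maps_into)
  let ?C = "(\<lambda>b. (\<lambda>h. b * h) ` {1, -1}) ` B"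
  have "?C \<subseteq> pm1_cosets" using r unfolding pm1_cosets_def by blast
  moreover have "B = \<Union>?C" using neg by auto
  ultimately show "\<exists>C\<subseteq>pm1_cosets. B = \<Union>C" by blast
qed

theorem proposition3p5:
  fixes S :: "'a::{field,finite} pg_point set" and A B :: "'a set"
  assumes "CARD('a) > 2"
    and "minimal_redei_blocking_set S"
    and "blocking_index S = 3"
    and "standard_triangle_position S"
    and "A = set_A S" and "B = set_B S"
    and "1 \<in> B"
  shows "(card (S \<inter> line 0 0 1) = CARD('a) \<longleftrightarrow>
            (\<forall>b0 \<in> B - {1}. \<exists>b0' \<in> B - {1}. b0 * b0' \<notin> B)) \<and>
         (card (S \<inter> line 0 0 1) = CARD('a) \<or> card (S \<inter> line 0 0 1) = CARD('a) - 1 \<longrightarrow>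
            (card (S \<inter> line 0 0 1) = CARD('a) - 1 \<longleftrightarrow>
               odd CARD('a) \<and> proper_union_of_pm1_cosets B))"
proof -
  let ?n = "card (S \<inter> line 0 0 1)" and ?H = "mult_stabilizer B"
  have n: "?n + card ?H = CARD('a) + 1"
    using card_redei_line[OF assms(2,4)] assms(6) by simp
  have 0: "0 \<notin> B" using assms(6) unfolding set_B_def by simp
  have q: "?n = CARD('a) \<longleftrightarrow> card ?H = 1" and q1: "?n = CARD('a) - 1 \<longleftrightarrow> card ?H = 2"
    using n assms(1) by linarith+
  have first: "?n = CARD('a) \<longleftrightarrow> (\<forall>b0 \<in> B - {1}. \<exists>b0' \<in> B - {1}. b0 * b0' \<notin> B)"
    unfolding q card_mult_stabilizer_eq_1_iff
    using 0 assms(7) by (intro mult_stabilizer_trivial_iff) auto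
  have "S \<subseteq> points"
    using assms(2) minimal_blocking_set_subset_points
    unfolding minimal_redei_blocking_set_def by blast
  then have "A \<noteq> {}" using set_A_nonempty assms(3,4,5) by blast
  then obtain a where "a \<noteq> 0" "a \<notin> uminus ` B"
    using set_A_eq[OF assms(2,4)] assms(5,6) by blast
  then have "- a \<noteq> 0" "- a \<notin> B" by (auto simp: image_iff)
  then have proper: "B \<noteq> {}" "B \<noteq> UNIV - {0}" using assms(7) by blast+
  have "card ?H = 2 \<longleftrightarrow> odd CARD('a) \<and> proper_union_of_pm1_cosets B"
    if "card ?H = 1 \<or> card ?H = 2"
  proof
    assume "card ?H = 2"
    then show "odd CARD('a) \<and> proper_union_of_pm1_cosets B"
      using mult_stabilizer_order_two[of B] proper 0
      by (simp add: odd_card_iff_neg_one_neq_one proper_union_of_pm1_cosets_def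
          union_of_pm1_cosets_iff)
  next
    assume "odd CARD('a) \<and> proper_union_of_pm1_cosets B"
    then have "(-1::'a) \<noteq> 1" "-1 \<in> ?H"
      by (simp_all add: odd_card_iff_neg_one_neq_one proper_union_of_pm1_cosets_def
          union_of_pm1_cosets_iff)
    then have "?H \<noteq> {1}" by auto
    then show "card ?H = 2" using that card_mult_stabilizer_eq_1_iff[of B] by blast
  qed
  then show ?thesis using first q q1 by blast
qed

end
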